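(* Let $r>2$ be an integer and let $m,n$ be integers with $2r+1<m\le n$. If the graph of an $\{r,r+1\}$-leaper on an $m\times n$ board has a Hamiltonian circuit, then $m\ge 4r+2$.
   Context: For positive integers $r,s$, the graph of an $\{r,s\}$-leaper on an $m\times n$ board has vertex set $\{(x,y): 0\le x<m,\ 0\le y<n\}$ (integers), with an edge between $(x,y)$ and $(x',y')$ whenever $(x'-x,y'-y)\in\{(\pm r,\pm s),(\pm s,\pm r)\}$. A Hamiltonian circuit is a cycle in the graph passing through every vertex exactly once. *)

theory Defs
  imports "Graph_Theory.Graph_Theory"
begin

text \<open>
  An undirected simple graph is represented, as in \<open>pair_graph\<close>, by a digraph with a
  symmetric, irreflexive set of arcs.
\<close>

definition board :: "int \<Rightarrow> int \<Rightarrow> (int \<times> int) set" where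
  "board m n = {0..<m} \<times> {0..<n}"

definition leaper_graph :: "int \<Rightarrow> int \<Rightarrow> int \<Rightarrow> int \<Rightarrow> (int \<times> int) pair_pre_digraph" where
  "leaper_graph r s m n =
    \<lparr> pverts = board m n,
      parcs = {((x, y), (x', y')) | x y x' y'.
        (x, y) \<in> board m n \<and> (x', y') \<in> board m n \<and>
        (x' - x, y' - y) \<in> {r, - r} \<times> {s, - s} \<union> {s, - s} \<times> {r, - r}} \<rparr>"

text \<open>
  The predicate \<^const>\<open>pre_digraph.cycle\<close> is directed and so also accepts walks
  \<open>a, b, a\<close> along a single undirected edge; these are excluded by the bound on the length.
  The tails of the arcs of a cycle are its vertices, each occurring as a tail exactly once.
\<close>

definition (in pre_digraph) hamiltonian_circuit :: "'b awalk \<Rightarrow> bool" where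
  "hamiltonian_circuit p \<longleftrightarrow> cycle p \<and> 3 \<le> length p \<and> tail G ` set p = verts G"

definition (in pre_digraph) hamiltonian :: bool where
  "hamiltonian \<longleftrightarrow> (\<exists>p. hamiltonian_circuit p)"

lemma pair_graph_leaper_graph:
  assumes "r > 0" "s > 0"
  shows "pair_graph (leaper_graph r s m n)"
proof
  show "finite (pverts (leaper_graph r s m n))"
    by (simp add: leaper_graph_def board_def)
  have "parcs (leaper_graph r s m n) \<subseteq> board m n \<times> board m n"
    by (auto simp: leaper_graph_def)
  then show "finite (parcs (leaper_graph r s m n))"
    by (rule finite_subset) (simp add: board_def)
  show "symmetric (with_proj (leaper_graph r s m n))"
    by (auto simp: symmetric_def leaper_graph_def intro!: symI)
qed (use assms in \<open>auto simp: leaper_graph_def\<close>)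

end

theory Submission
  imports Defs
begin

text \<open>
  Only the bottom edge of the board matters. The squares of the two \<open>r \<times> r\<close> corners there have
  exactly two neighbours, so the circuit uses all edges at them. If \<open>m \<le> 4r\<close>, the regions
  reached from the two corners overlap so much that some square lies on three such edges. If
  \<open>m = 4r + 1\<close>, then \<open>(2r, r + 2)\<close> and \<open>(2r + 1, r + 1)\<close> both get their two circuit edges from
  the corners, which leaves \<open>(r, 1)\<close> only one possible neighbour on the circuit.
\<close>

text \<open>Numbering the vertices cyclically along the circuit, the arcs at \<open>t i\<close> lead
  to its successor and its predecessor only, and these differ because the length is at least
  3.\<close>

lemma (in wf_digraph) card_circuit_neighbours:
  assumes circ: "hamiltonian_circuit p" and v: "v \<in> verts G"
  shows "card {w. \<exists>e\<in>set p. arc_to_ends G e = (v, w) \<or> arc_to_ends G e = (w, v)} = 2"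
proof -
  define k where "k = length p"
  \<comment> \<open>Reducing the index modulo \<open>k\<close> lets the closing arc be treated like
    all others.\<close>
  define t where "t i = tail G (p ! (i mod k))" for i
  have k: "3 \<le> k"
    using circ by (simp add: hamiltonian_circuit_def k_def)
  obtain u where u: "awalk u p u" "distinct (tl (awalk_verts u p))" "p \<noteq> []"
    using circ by (auto simp: hamiltonian_circuit_def cycle_def)
  have cas: "cas u p u"
    using u(1) by (auto simp: awalk_def)
  have verts1: "awalk_verts u p = map (tail G) p @ [head G (last p)]"
    using u(3) by (simp add: awalk_verts_conv)
  have verts2: "awalk_verts u p = u # map (head G) p"
    using cas u(3) by (metis awalk_verts_conv' cas_simp)
  have head_last: "head G (last p) = u"
    using verts1 u(1) by (auto elim!: awalkE)
  have head_p: "head G (p ! i) = t (Suc i)" if "i < k" for i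
  proof (cases "Suc i < k")
    case True
    have "head G (p ! i) = awalk_verts u p ! Suc i"
      using that by (simp add: verts2 k_def)
    also have "\<dots> = t (Suc i)"
      using True by (simp add: verts1 t_def k_def nth_append)
    finally show ?thesis .
  next
    case False
    then have Suc_i: "Suc i = length p"
      using that by (simp add: k_def)
    then have "i = length p - 1"
      by simp
    then have "head G (p ! i) = u" "t (Suc i) = tail G (p ! 0)"
      using head_last u(3) Suc_i by (simp_all add: last_conv_nth k_def t_def)
    then show ?thesis
      using cas u(3) by (simp add: cas_simp hd_conv_nth)
  qed
  have ends: "arc_to_ends G (p ! i) = (t i, t (Suc i))" if "i < k" for i
    using that head_p by (simp add: arc_to_ends_def t_def)
  \<comment> \<open>\<open>cycle\<close> gives distinctness of the vertices after the first one,
    that is, of the heads. Reading the closed vertex sequence in two ways shows that tails and heads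
    agree as multisets, which carries distinctness over to the tails.\<close>
  have "map (tail G) p @ [u] = u # map (head G) p"
    using verts1 verts2 head_last by simp
  then have "mset (map (tail G) p @ [u]) = mset (u # map (head G) p)"
    by (rule arg_cong)
  then have "mset (map (tail G) p) = mset (map (head G) p)"
    by simp
  then have "distinct (map (tail G) p)"
    using u(2) verts2 mset_eq_imp_distinct_iff by fastforce
  then have inj: "t i = t j \<longleftrightarrow> i mod k = j mod k" for i j
    using nth_eq_iff_index_eq[of "map (tail G) p" "i mod k" "j mod k"] u(3)
    by (simp add: t_def k_def)
  obtain i where i: "i < k" "t i = v"
  proof -
    obtain e where "e \<in> set p" "tail G e = v"
      using circ v by (metis hamiltonian_circuit_def imageE)
    then show thesis
      using that by (metis in_set_conv_nth k_def mod_less t_def)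
  qed
  \<comment> \<open>The predecessor has index \<open>i + k - 1\<close> rather than
    \<open>i - 1\<close>, since natural subtraction would truncate at \<open>i = 0\<close>.\<close>
  have set_eq: "{w. \<exists>e\<in>set p. arc_to_ends G e = (v, w) \<or> arc_to_ends G e = (w, v)}
      = {t (i + 1), t (i + k - 1)}"
  proof (intro subset_antisym subsetI)
    fix w assume "w \<in> {w. \<exists>e\<in>set p. arc_to_ends G e = (v, w) \<or> arc_to_ends G e = (w, v)}"
    then obtain j where j: "j < k"
        "(t j, t (Suc j)) = (v, w) \<or> (t j, t (Suc j)) = (w, v)"
      using ends by (auto simp: in_set_conv_nth k_def)
    from j(2) show "w \<in> {t (i + 1), t (i + k - 1)}"
    proof
      assume "(t j, t (Suc j)) = (v, w)"
      then show ?thesis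
        using i j(1) inj by auto
    next
      assume "(t j, t (Suc j)) = (w, v)"
      then have "Suc j mod k = Suc (i + k - 1) mod k" and w: "w = t j"
        using i inj[of "Suc j" i] k by auto
      then have "j mod k = (i + k - 1) mod k"
        by (simp add: mod_Suc split: if_splits)
      then show ?thesis
        using inj w by auto
    qed
  next
    fix w assume "w \<in> {t (i + 1), t (i + k - 1)}"
    then consider "w = t (i + 1)" | "w = t (i + k - 1)"
      by blast
    then show "w \<in> {w. \<exists>e\<in>set p. arc_to_ends G e = (v, w) \<or> arc_to_ends G e = (w, v)}"
    proof cases
      case 1
      then show ?thesis
        using ends[of i] i by (auto simp: k_def intro!: bexI[of _ "p ! i"])
    next
      case 2
      \<comment> \<open>\<open>ends\<close> only speaks of indices below \<open>k\<close>, hence the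
        explicit remainder.\<close>
      define j where "j = (i + k - 1) mod k"
      have "j < k"
        using k by (simp add: j_def)
      moreover have "t j = w" "t (Suc j) = v"
        using 2 i k by (simp_all add: t_def j_def mod_Suc_eq)
      ultimately show ?thesis
        using ends[of j] by (auto simp: k_def intro!: bexI[of _ "p ! j"])
    qed
  qed
  have "t (i + 1) \<noteq> t (i + k - 1)"
  proof
    assume "t (i + 1) = t (i + k - 1)"
    moreover have "i + k - 1 = i + 1 + (k - 2)"
      using k by simp
    ultimately have "(i + 1) mod k = (i + 1 + (k - 2)) mod k"
      using inj by metis
    then have "k dvd (k - 2)"
      by (metis add_diff_cancel_left' mod_eq_dvd_iff_nat le_add1)
    then show False
      using k by (auto dest: dvd_imp_le)
  qed
  then show ?thesis
    by (simp add: set_eq)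
qed

locale leaper_circuit =
  fixes r m n :: int and p :: "((int \<times> int) \<times> (int \<times> int)) list"
  assumes r: "r > 2" and m: "2 * r + 1 < m" and n: "m \<le> n"
    and circ: "pre_digraph.hamiltonian_circuit (with_proj (leaper_graph r (r + 1) m n)) p"
begin

definition nbs :: "int \<times> int \<Rightarrow> (int \<times> int) set" where
  "nbs v = {w. (v, w) \<in> set p \<or> (w, v) \<in> set p}"

lemma nbs_sym: "w \<in> nbs v \<longleftrightarrow> v \<in> nbs w"
  by (auto simp: nbs_def)

lemma card_nbs:
  assumes "v \<in> board m n"
  shows "card (nbs v) = 2"
proof -
  interpret pair_graph "leaper_graph r (r + 1) m n"
    using r by (intro pair_graph_leaper_graph) auto
  have "v \<in> pverts (leaper_graph r (r + 1) m n)"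
    using assms by (simp add: leaper_graph_def)
  moreover have "nbs v = {w. \<exists>e\<in>set p.
      arc_to_ends (with_proj (leaper_graph r (r + 1) m n)) e = (v, w) \<or>
      arc_to_ends (with_proj (leaper_graph r (r + 1) m n)) e = (w, v)}"
    by (auto simp: nbs_def arc_to_ends_def)
  ultimately show ?thesis
    using card_circuit_neighbours circ by simp
qed

text \<open>Absolute values hide the direction in which the circuit runs through the edge and merge
  the eight moves into two cases of linear arithmetic.\<close>

lemma nbsD:
  assumes "(x', y') \<in> nbs (x, y)"
  shows "0 \<le> x'" "x' < m" "0 \<le> y'" "y' < n"
    and "\<bar>x' - x\<bar> = r \<and> \<bar>y' - y\<bar> = r + 1 \<or> \<bar>x' - x\<bar> = r + 1 \<and> \<bar>y' - y\<bar> = r"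
proof -
  have arc: "(x, y) \<in> board m n \<and> (x', y') \<in> board m n \<and>
      (\<bar>x' - x\<bar> = r \<and> \<bar>y' - y\<bar> = r + 1 \<or> \<bar>x' - x\<bar> = r + 1 \<and> \<bar>y' - y\<bar> = r)"
    if "((x, y), (x', y')) \<in> parcs (leaper_graph r (r + 1) m n)" for x y x' y'
    using that r by (simp add: leaper_graph_def abs_eq_iff') blast
  have "set p \<subseteq> parcs (leaper_graph r (r + 1) m n)"
    using circ
    by (auto simp: pre_digraph.hamiltonian_circuit_def pre_digraph.cycle_def pre_digraph.awalk_def)
  then have "((x, y), (x', y')) \<in> parcs (leaper_graph r (r + 1) m n) \<or>
      ((x', y'), (x, y)) \<in> parcs (leaper_graph r (r + 1) m n)"
    using assms by (auto simp: nbs_def)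
  then have "(x', y') \<in> board m n \<and>
      (\<bar>x' - x\<bar> = r \<and> \<bar>y' - y\<bar> = r + 1 \<or> \<bar>x' - x\<bar> = r + 1 \<and> \<bar>y' - y\<bar> = r)"
    using arc abs_minus_commute by metis
  then show "0 \<le> x'" "x' < m" "0 \<le> y'" "y' < n"
    and "\<bar>x' - x\<bar> = r \<and> \<bar>y' - y\<bar> = r + 1 \<or> \<bar>x' - x\<bar> = r + 1 \<and> \<bar>y' - y\<bar> = r"
    by (simp_all add: board_def)
qed

text \<open>Two circuit edges are needed at every square, so a square with at most two candidate
  neighbours must use both.\<close>

lemma nbs_eqI:
  assumes v: "v \<in> board m n" and sub: "nbs v \<subseteq> {a, b}"
  shows "nbs v = {a, b}"
proof (rule card_seteq[OF _ sub])
  show "card {a, b} \<le> card (nbs v)"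
    unfolding card_nbs[OF v] by (simp add: card_insert_if)
qed simp

text \<open>Both coordinates are below \<open>r\<close>, so neither can decrease by \<open>r\<close>
  or \<open>r + 1\<close>; only the two moves that increase both remain.\<close>

lemma nbs_left_corner:
  assumes "0 \<le> x" "x < r" "0 \<le> y" "y < r"
  shows "nbs (x, y) = {(x + r, y + (r + 1)), (x + (r + 1), y + r)}"
proof (rule nbs_eqI)
  show "(x, y) \<in> board m n"
    using assms r m n by (simp add: board_def)
  show "nbs (x, y) \<subseteq> {(x + r, y + (r + 1)), (x + (r + 1), y + r)}"
  proof
    fix w assume "w \<in> nbs (x, y)"
    moreover obtain a b where w: "w = (a, b)"
      by fastforce
    ultimately have "(a, b) = (x + r, y + (r + 1)) \<or> (a, b) = (x + (r + 1), y + r)"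
      using nbsD[of a b x y] assms m by (smt (verit))
    then show "w \<in> {(x + r, y + (r + 1)), (x + (r + 1), y + r)}"
      using w by simp
  qed
qed

lemma nbs_right_corner:
  assumes "m - r \<le> x" "x < m" "0 \<le> y" "y < r"
  shows "nbs (x, y) = {(x - r, y + (r + 1)), (x - (r + 1), y + r)}"
proof (rule nbs_eqI)
  show "(x, y) \<in> board m n"
  proof -
    have "0 \<le> x" "y < n"
      using assms r m n by linarith+
    then show ?thesis
      using assms(2,3) by (simp add: board_def)
  qed
  show "nbs (x, y) \<subseteq> {(x - r, y + (r + 1)), (x - (r + 1), y + r)}"
  proof
    fix w assume "w \<in> nbs (x, y)"
    moreover obtain a b where w: "w = (a, b)"
      by fastforce
    ultimately have "(a, b) = (x - r, y + (r + 1)) \<or> (a, b) = (x - (r + 1), y + r)"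
      using nbsD[of a b x y] assms m by (smt (verit))
    then show "w \<in> {(x - r, y + (r + 1)), (x - (r + 1), y + r)}"
      using w by simp
  qed
qed

text \<open>Counterpart of \<open>nbs_eqI\<close>: two known circuit edges at a square exclude any
  third.\<close>

lemma nbs_eq_pairI:
  assumes "v \<in> board m n" "a \<in> nbs v" "b \<in> nbs v" "a \<noteq> b"
  shows "nbs v = {a, b}"
proof -
  have "finite (nbs v)"
    using card_nbs[OF assms(1)] by (simp add: card_ge_0_finite)
  then show ?thesis
    using assms card_nbs[OF assms(1)] by (intro card_seteq[symmetric]) auto
qed

lemma width_gt_4r: "m > 4 * r"
proof (rule ccontr)
  assume m': "\<not> m > 4 * r"
  \<comment> \<open>Row \<open>r + 1\<close> is reached from corner rows 0 and 1. Both left edges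
    end in column \<open>u\<close> if r + 1 \<le> u \<le> 2r - 1, and at least one right edge does
    if m - 1 - 2r \<le> u \<le> m - 1 - r. For 2r + 2 \<le> m \<le> 4r these ranges meet, and
    \<open>u\<close> is their least common column.\<close>
  define u where "u = max (r + 1) (m - 1 - 2 * r)"
  have u: "r + 1 \<le> u" "u < 2 * r" "m - 1 - 2 * r \<le> u" "u \<le> m - 1 - r"
    using r m m' by (auto simp: u_def)
  have "(u - r, 0) \<in> nbs (u, r + 1)"
    using nbs_left_corner[of "u - r" 0] u r by (simp add: nbs_sym[of _ "(u, r + 1)"])
  moreover have "(u - (r + 1), 1) \<in> nbs (u, r + 1)"
    using nbs_left_corner[of "u - (r + 1)" 1] u r by (simp add: nbs_sym[of _ "(u, r + 1)"])
  ultimately have nbs_u: "nbs (u, r + 1) = {(u - r, 0), (u - (r + 1), 1)}"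
    using u r m n by (intro nbs_eq_pairI) (auto simp: board_def)
  show False
  proof (cases "m - r \<le> u + r")
    case True
    have "(u + r, 0) \<in> nbs (u, r + 1)"
      using nbs_right_corner[of "u + r" 0] True u r by (simp add: nbs_sym[of _ "(u, r + 1)"])
    then show False
      using nbs_u r by simp
  next
    \<comment> \<open>Here u = m - 1 - 2r, so \<open>u + (r + 1)\<close> is the first column of the
      right corner.\<close>
    case False
    have "(u + (r + 1), 1) \<in> nbs (u, r + 1)"
      using nbs_right_corner[of "u + (r + 1)" 1] False u r
      by (simp add: nbs_sym[of _ "(u, r + 1)"])
    then show False
      using nbs_u r by simp
  qed
qed

lemma width_neq_4r_plus_1: "m \<noteq> 4 * r + 1"
proof
  assume m_eq: "m = 4 * r + 1"
  \<comment> \<open>The two edges come from the innermost columns r - 1 and 3r + 1 = m - r of the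
    corners; row 2 belongs to the corners because r > 2.\<close>
  have "nbs (2 * r, r + 2) = {(r - 1, 2), (3 * r + 1, 2)}"
    using nbs_left_corner[of "r - 1" 2] nbs_right_corner[of "3 * r + 1" 2] r n m_eq
    by (intro nbs_eq_pairI) (auto simp: board_def nbs_sym[of _ "(2 * r, r + 2)"])
  then have A: "(2 * r, r + 2) \<notin> nbs (r, 1)"
    using nbs_sym by auto
  have "nbs (2 * r + 1, r + 1) = {(3 * r + 1, 0), (3 * r + 2, 1)}"
    using nbs_right_corner[of "3 * r + 1" 0] nbs_right_corner[of "3 * r + 2" 1] r n m_eq
    by (intro nbs_eq_pairI) (auto simp: board_def nbs_sym[of _ "(2 * r + 1, r + 1)"])
  then have B: "(2 * r + 1, r + 1) \<notin> nbs (r, 1)"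
    using nbs_sym r by auto
  \<comment> \<open>Downward moves from (r, 1) leave the board, and so does the upward move to
    column -1. Of the other three upward moves, \<open>A\<close> and \<open>B\<close> rule out
    two.\<close>
  have "nbs (r, 1) \<subseteq> {(0, r + 2)}"
  proof
    fix w assume w: "w \<in> nbs (r, 1)"
    then have "w \<noteq> (2 * r, r + 2)" "w \<noteq> (2 * r + 1, r + 1)"
      using A B by auto
    moreover obtain a b where ab: "w = (a, b)"
      by fastforce
    ultimately have "a = 0" "b = r + 2"
      using nbsD[of a b r 1] w r by (smt (verit))+
    then show "w \<in> {(0, r + 2)}"
      using ab by simp
  qed
  then have "card (nbs (r, 1)) \<le> card {(0 :: int, r + 2)}"
    by (intro card_mono) simp_all
  moreover have "(r, 1) \<in> board m n"
    using r m n by (simp add: board_def)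
  ultimately show False
    using card_nbs by simp
qed

end

theorem theorem2:
  fixes r m n :: int
  assumes "r > 2" and "2 * r + 1 < m" and "m \<le> n"
    and "pre_digraph.hamiltonian (with_proj (leaper_graph r (r + 1) m n))"
  shows "m \<ge> 4 * r + 2"
proof -
  obtain p where "leaper_circuit r m n p"
    using assms by (auto simp: pre_digraph.hamiltonian_def leaper_circuit_def)
  then show ?thesis
    using leaper_circuit.width_gt_4r leaper_circuit.width_neq_4r_plus_1 by fastforce
qed

end
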